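(* Let $A\in\mathbb{C}^{n\times n}$ have index $k$ and satisfy $\operatorname{rank}(A^{\sim}AA^{\sim})=\operatorname{rank}(A)$, let $b\in\mathbb{C}^{n}$, and consider the system of linear equations $$A^{k}x=A^{k}A^{\mathfrak{m}}b$$ in the unknown $x\in\mathbb{C}^n$. Then the general solution of this system is $$x=A^{D,\mathfrak{m}}b+(I_n-A^{D,\mathfrak{m}}A)v,$$ where $v\in\mathbb{C}^{n}$ is arbitrary. Moreover, $x=A^{D,\mathfrak{m}}b$ is the unique solution of this system in $\mathcal{R}(A^{k})$.
   Context: $\mathcal{R}(\cdot)$ denotes the range. The index of $A\in\mathbb{C}^{n\times n}$ is the smallest nonnegative integer $k$ with $\operatorname{rank}(A^{k+1})=\operatorname{rank}(A^{k})$. The Minkowski metric matrix of order $n$ is $G=\operatorname{diag}(1,-I_{n-1})$. For $A\in\mathbb{C}^{n\times n}$, the Minkowski adjoint is $A^{\sim}=GA^{*}G$, where $A^*$ is the conjugate transpose. The Drazin inverse $A^{D}$ of $A$ (of index $k$) is the unique $X$ with $XAX=X$, $AX=XA$, $A^{k+1}X=A^{k}$. The Minkowski inverse $A^{\mathfrak{m}}$ is the unique matrix $X$ (if it exists) with $AXA=A$, $XAX=X$, $(AX)^{\sim}=AX$, $(XA)^{\sim}=XA$; it exists if and only if $\operatorname{rank}(A^{\sim}AA^{\sim})=\operatorname{rank}(A)$. When it exists, the $\mathfrak{m}$-DMP inverse of $A$ is $A^{D,\mathfrak{m}}=A^{D}AA^{\mathfrak{m}}$. *)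

theory Defs
  imports
    Complex_Main
    "Jordan_Normal_Form.Matrix"
    "Jordan_Normal_Form.Schur_Decomposition"
    "Jordan_Normal_Form.DL_Rank"
begin

abbreviation mat_rank :: "complex mat \<Rightarrow> nat" where
  "mat_rank A \<equiv> vec_space.rank (dim_row A) A"

definition mat_range :: "complex mat \<Rightarrow> complex vec set" where
  "mat_range A = {A *\<^sub>v x | x. x \<in> carrier_vec (dim_col A)}"

definition mat_index :: "complex mat \<Rightarrow> nat" where
  "mat_index A = (LEAST k. mat_rank (A ^\<^sub>m (k + 1)) = mat_rank (A ^\<^sub>m k))"

text \<open>The Minkowski metric matrix $\mathrm{diag}(1, -I_{n-1})$; its first row has index 0.\<close>

definition minkowski_metric :: "nat \<Rightarrow> complex mat" where
  "minkowski_metric n = mat_diag n (\<lambda>i. if i = 0 then 1 else - 1)"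

text \<open>
  For square matrices the two metrics below coincide.  The function \<open>mat_adjoint\<close> is the
  conjugate transpose.
\<close>

definition minkowski_adjoint :: "complex mat \<Rightarrow> complex mat" where
  "minkowski_adjoint A =
     minkowski_metric (dim_col A) * mat_adjoint A * minkowski_metric (dim_row A)"

definition is_drazin_inverse :: "complex mat \<Rightarrow> complex mat \<Rightarrow> bool" where
  "is_drazin_inverse A X \<longleftrightarrow>
     X \<in> carrier_mat (dim_row A) (dim_row A) \<and>
     X * A * X = X \<and>
     A * X = X * A \<and>
     A ^\<^sub>m (mat_index A + 1) * X = A ^\<^sub>m mat_index A"

definition drazin_inverse :: "complex mat \<Rightarrow> complex mat" where
  "drazin_inverse A = (THE X. is_drazin_inverse A X)"

definition is_minkowski_inverse :: "complex mat \<Rightarrow> complex mat \<Rightarrow> bool" where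
  "is_minkowski_inverse A X \<longleftrightarrow>
     X \<in> carrier_mat (dim_col A) (dim_row A) \<and>
     A * X * A = A \<and>
     X * A * X = X \<and>
     minkowski_adjoint (A * X) = A * X \<and>
     minkowski_adjoint (X * A) = X * A"

text \<open>
  The description below denotes the Minkowski inverse only if one exists, that is, for square
  matrices, if the rank of \<open>minkowski_adjoint A * A * minkowski_adjoint A\<close> equals that of \<open>A\<close>.
\<close>

definition minkowski_inverse :: "complex mat \<Rightarrow> complex mat" where
  "minkowski_inverse A = (THE X. is_minkowski_inverse A X)"

definition m_DMP_inverse :: "complex mat \<Rightarrow> complex mat" where
  "m_DMP_inverse A = drazin_inverse A * A * minkowski_inverse A"

end

theory Submission
  imports Defs
begin

text \<open>
  Write $D = A^D$, $M = A^{\mathfrak{m}}$ and $F = DA$. Since $AMA = A$, the matrix $F$ equals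
  $A^{D,\mathfrak{m}}A$, and $A^{D,\mathfrak{m}}b = F(Mb)$. The properties of the Drazin inverse
  make $F$ the idempotent with the same kernel and the same range as $A^k$: it is of the form
  $A^k Y'$ and of the form $Z' A^k$, and $F A^k = A^k = A^k F$. So the system $A^k x = A^k (Mb)$ says
  the same as $F x = F (Mb)$. Its solutions are $F(Mb)$ plus the kernel of $F$, which is the range of
  $I - F$; and $F$ fixes the range of $A^k$ pointwise, so $F(Mb)$ is the only solution there.

  Both inverses are defined by descriptions, so what remains is that each exists and is unique. They
  are two cases of one notion, the inverse of $A$ along a matrix $d$ (introduced by X. Mary): a
  matrix $X$ with $XAd = d = dAX$ that is a right and a left multiple of $d$. Such an $X$ is unique
  by a one-line computation, and it exists as soon as $dAd$ has the same rank as $d$, because then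
  $d$ is both a right and a left multiple of $dAd$. The Drazin inverse is the inverse along $A^k$,
  and the ranks agree because the ranks of the powers are constant from the index on. The Minkowski
  inverse is the inverse along $A^\sim$, and the ranks agree by hypothesis and because $A^\sim$ has
  the rank of $A$.
\<close>

section \<open>Rank and factorizations\<close>

context vec_space begin

text \<open>
  The usual comparison of a linearly independent set with the dimension of the space that contains
  it, for the column space. All dimension counts below go through these two facts.
\<close>
lemma independent_in_column_space:
  assumes A: "A \<in> carrier_mat n m"
    and T: "T \<subseteq> span (set (cols A))" "lin_indpt T"
  shows "card T \<le> rank A"
    and "rank A \<le> card T \<Longrightarrow> span T = span (set (cols A))"
proof -
  let ?S = "set (cols A)"
  have S: "?S \<subseteq> carrier_vec n" using A cols_dim[of A] by auto
  have sub: "submodule class_ring (span ?S) V" by (rule span_is_submodule[OF S])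
  interpret W: vectorspace class_ring "vs (span ?S)"
    by (rule subspace_is_vs) (unfold VectorSpace.subspace_def, intro conjI vectorspace_axioms sub)
  have fd: "W.fin_dim"
    unfolding W.fin_dim_def
    by (rule exI[of _ ?S])
      (use in_own_span[OF S] span_li_not_depend(1)[OF in_own_span[OF S] sub] in auto)
  have li: "W.lin_indpt T" using span_li_not_depend(2)[OF T(1) sub] T(2) by simp
  have fin: "finite T" and le: "card T \<le> rank A"
    using W.li_le_dim[OF fd _ li] T(1) unfolding rank_def by auto
  show "card T \<le> rank A" by (rule le)
  assume "rank A \<le> card T"
  then have "W.basis T"
    by (intro W.dim_li_is_basis[OF fd fin _ li]) (use T(1) in \<open>auto simp: rank_def\<close>)
  then show "span T = span ?S"
    using span_li_not_depend(1)[OF T(1) sub] by (simp add: W.basis_def)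
qed

lemma column_basis:
  assumes A: "A \<in> carrier_mat n m"
  obtains S where "S \<subseteq> set (cols A)" "lin_indpt S" "finite S" "card S = rank A"
    "span S = span (set (cols A))"
proof -
  have "lin_indpt {}" using finite_lin_indpt2[of "{}"] by auto
  then obtain S where fin: "finite S" and max: "maximal S (\<lambda>T. T \<subseteq> set (cols A) \<and> lin_indpt T)"
    using maximal_exists_superset[of "set (cols A)" "\<lambda>T. T \<subseteq> set (cols A) \<and> lin_indpt T" "{}"]
    by auto
  then have S: "S \<subseteq> set (cols A)" "lin_indpt S" by (auto simp: maximal_def)
  have card: "card S = rank A" using rank_card_indpt[OF A max] by simp
  have c: "set (cols A) \<subseteq> carrier_vec n" using A cols_dim[of A] by auto
  have "span S = span (set (cols A))"
    by (rule independent_in_column_space(2)[OF A _ S(2)]) (use S in_own_span[OF c] card in auto)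
  with that S fin card show ?thesis by blast
qed

lemma left_factor_if_columns_in_range:
  assumes A: "A \<in> carrier_mat n m" and C: "C \<in> carrier_mat n p"
    and cols: "set (cols A) \<subseteq> span (set (cols C))"
  obtains R where "R \<in> carrier_mat p m" "A = C * R"
proof -
  have "\<exists>x \<in> carrier_vec p. C *\<^sub>v x = col A j" if "j < m" for j
  proof -
    have "col A j \<in> col_space C"
      using that A cols unfolding col_space_def
      by (metis carrier_matD(2) cols_length cols_nth nth_mem subsetD)
    then show ?thesis using col_space_eq[OF C] C by auto
  qed
  then obtain x where x: "\<And>j. j < m \<Longrightarrow> x j \<in> carrier_vec p \<and> C *\<^sub>v x j = col A j"
    by metis
  let ?R = "mat_of_cols p (map x [0..<m])"
  have R: "?R \<in> carrier_mat p m" by auto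
  have "A = C * ?R"
  proof (rule mat_col_eqI)
    fix j assume "j < dim_col (C * ?R)"
    then have j: "j < m" by simp
    then have "col ?R j = x j" using x by (subst col_mat_of_cols) auto
    then show "col A j = col (C * ?R) j" using x[OF j] j by (subst col_mult2[OF C R j]) simp
  qed (use A C in auto)
  from R this show ?thesis by (rule that)
qed

lemma columns_of_product:
  assumes A: "A \<in> carrier_mat n m" and B: "B \<in> carrier_mat m p"
  shows "set (cols (A * B)) \<subseteq> span (set (cols A))"
proof
  fix y assume "y \<in> set (cols (A * B))"
  then obtain j where "j < p" "y = col (A * B) j"
    using B by (auto simp: cols_def)
  then have "y = A *\<^sub>v col B j" "col B j \<in> carrier_vec m"
    using col_mult2[OF A B] B by auto
  then have "y \<in> col_space A" using col_space_eq[OF A] A by auto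
  then show "y \<in> span (set (cols A))" by (simp add: col_space_def)
qed

lemma rank_mult_le_left:
  assumes A: "A \<in> carrier_mat n m" and B: "B \<in> carrier_mat m p"
  shows "rank (A * B) \<le> rank A"
proof -
  obtain S where S: "S \<subseteq> set (cols (A * B))" "lin_indpt S" "card S = rank (A * B)"
    using column_basis[OF mult_carrier_mat[OF A B]] .
  then show ?thesis
    using independent_in_column_space(1)[OF A _ S(2)] columns_of_product[OF A B] by auto
qed

text \<open>
  The column space of $AB$ lies in that of $A$. If the dimensions agree, then the two are equal, so
  that every column of $A$ is a combination of columns of $AB$.
\<close>
lemma right_factor_if_rank_mult_eq:
  assumes A: "A \<in> carrier_mat n m" and B: "B \<in> carrier_mat m p"
    and rk: "rank (A * B) = rank A"
  obtains Y where "Y \<in> carrier_mat p m" "A = A * B * Y"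
proof -
  have AB: "A * B \<in> carrier_mat n p" using A B by simp
  obtain S where S: "S \<subseteq> set (cols (A * B))" "lin_indpt S" "card S = rank (A * B)"
    "span S = span (set (cols (A * B)))"
    using column_basis[OF AB] .
  have "span S = span (set (cols A))"
    by (rule independent_in_column_space(2)[OF A order.trans[OF S(1) columns_of_product[OF A B]] S(2)])
      (simp add: S(3) rk)
  then have "set (cols A) \<subseteq> span (set (cols (A * B)))"
    using S(4) in_own_span[of "set (cols A)"] A cols_dim[of A] by simp
  from left_factor_if_columns_in_range[OF A AB this] obtain Y
    where Y: "Y \<in> carrier_mat p m" "A = A * B * Y" .
  show ?thesis by (rule that[OF Y])
qed

text \<open>
  A basis of the column space, chosen among the columns, gives the first factor. This is how the rank
  of the adjoint is compared with that of the matrix: the adjoint of $CR$ factors through the same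
  inner dimension.
\<close>
lemma rank_factorization:
  assumes A: "A \<in> carrier_mat n m"
  obtains C R where "C \<in> carrier_mat n (rank A)" "R \<in> carrier_mat (rank A) m" "A = C * R"
proof -
  obtain S where S: "S \<subseteq> set (cols A)" "finite S" "card S = rank A"
    "span S = span (set (cols A))"
    using column_basis[OF A] .
  obtain xs where xs: "set xs = S" "length xs = rank A"
    using finite_distinct_list[OF S(2)] distinct_card S(3) by metis
  have c: "set (cols A) \<subseteq> carrier_vec n" using A cols_dim[of A] by auto
  let ?C = "mat_of_cols n xs"
  have C: "?C \<in> carrier_mat n (rank A)" using xs(2) by auto
  have "set (cols ?C) = S" using S(1) xs(1) c by (subst cols_mat_of_cols) auto
  then have "set (cols A) \<subseteq> span (set (cols ?C))" using in_own_span[OF c] S(4) by simp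
  from left_factor_if_columns_in_range[OF A C this] obtain R
    where R: "R \<in> carrier_mat (rank A) m" "A = ?C * R" .
  show ?thesis by (rule that[OF C R])
qed

end

section \<open>The Minkowski adjoint\<close>

lemma minkowski_adjoint_carrier [simp]:
  "A \<in> carrier_mat n m \<Longrightarrow> minkowski_adjoint A \<in> carrier_mat m n"
  by (auto simp: minkowski_adjoint_def minkowski_metric_def mat_diag_def)

lemma minkowski_adjoint_index:
  assumes "A \<in> carrier_mat n m" "i < m" "j < n"
  shows "minkowski_adjoint A $$ (i, j) =
    (if i = 0 then 1 else - 1) * cnj (A $$ (j, i)) * (if j = 0 then 1 else - 1)"
proof -
  have H: "mat_adjoint A \<in> carrier_mat m n"
    using assms(1) by (auto simp: mat_adjoint_def)
  moreover have "mat_adjoint A $$ (i, j) = cnj (A $$ (j, i))"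
    using assms by (auto simp: mat_adjoint_def mat_of_rows_index)
  ultimately show ?thesis
    using assms
    by (simp add: minkowski_adjoint_def minkowski_metric_def mat_diag_mult_left[OF H]
        mat_diag_mult_right[of _ m n])
qed

lemma minkowski_adjoint_involutive:
  assumes A: "A \<in> carrier_mat n m"
  shows "minkowski_adjoint (minkowski_adjoint A) = A"
proof (rule eq_matI)
  note A' = minkowski_adjoint_carrier[OF A]
  show "dim_row (minkowski_adjoint (minkowski_adjoint A)) = dim_row A"
    and "dim_col (minkowski_adjoint (minkowski_adjoint A)) = dim_col A"
    using carrier_matD[OF A] carrier_matD[OF minkowski_adjoint_carrier[OF A']] by simp_all
  fix i j assume "i < dim_row A" "j < dim_col A"
  then show "minkowski_adjoint (minkowski_adjoint A) $$ (i, j) = A $$ (i, j)"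
    using A by (auto simp: minkowski_adjoint_index[OF A'] minkowski_adjoint_index[OF A])
qed

lemma minkowski_adjoint_mult:
  assumes A: "A \<in> carrier_mat n m" and B: "B \<in> carrier_mat m p"
  shows "minkowski_adjoint (A * B) = minkowski_adjoint B * minkowski_adjoint A"
proof (rule eq_matI)
  have AB: "A * B \<in> carrier_mat n p" using A B by simp
  have A': "minkowski_adjoint A \<in> carrier_mat m n" and B': "minkowski_adjoint B \<in> carrier_mat p m"
    using A B by simp_all
  fix i j assume "i < dim_row (minkowski_adjoint B * minkowski_adjoint A)"
    and "j < dim_col (minkowski_adjoint B * minkowski_adjoint A)"
  then have i: "i < p" and j: "j < n" using A' B' by auto
  have "(minkowski_adjoint B * minkowski_adjoint A) $$ (i, j) =
      (\<Sum>l = 0..<m. minkowski_adjoint B $$ (i, l) * minkowski_adjoint A $$ (l, j))"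
    using A' B' i j by (auto simp: scalar_prod_def)
  also have "\<dots> = (\<Sum>l = 0..<m. (if i = 0 then 1 else - 1) * (if j = 0 then 1 else - 1) *
      (cnj (B $$ (l, i)) * cnj (A $$ (j, l))))"
    by (rule sum.cong) (auto simp: minkowski_adjoint_index[OF A _ j] minkowski_adjoint_index[OF B i])
  also have "\<dots> = (if i = 0 then 1 else - 1) * (if j = 0 then 1 else - 1) *
      (\<Sum>l = 0..<m. cnj (B $$ (l, i)) * cnj (A $$ (j, l)))"
    by (simp only: sum_distrib_left)
  also have "\<dots> = minkowski_adjoint (A * B) $$ (i, j)"
    using A B i j by (simp add: minkowski_adjoint_index[OF AB i j] scalar_prod_def mult.commute)
  finally show "minkowski_adjoint (A * B) $$ (i, j) =
    (minkowski_adjoint B * minkowski_adjoint A) $$ (i, j)" by simp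
qed (use A B minkowski_adjoint_carrier[OF A] minkowski_adjoint_carrier[OF B]
    minkowski_adjoint_carrier[OF mult_carrier_mat[OF A B]] in \<open>simp_all only: carrier_matD index_mult_mat\<close>)

lemma rank_minkowski_adjoint_le:
  assumes A: "A \<in> carrier_mat n m"
  shows "vec_space.rank m (minkowski_adjoint A) \<le> vec_space.rank n A"
proof -
  let ?r = "vec_space.rank n A"
  obtain C R where CR: "C \<in> carrier_mat n ?r" "R \<in> carrier_mat ?r m" "A = C * R"
    using vec_space.rank_factorization[OF A] .
  have "vec_space.rank m (minkowski_adjoint A) =
      vec_space.rank m (minkowski_adjoint R * minkowski_adjoint C)"
    by (subst CR(3)) (simp add: minkowski_adjoint_mult[OF CR(1,2)])
  also have "\<dots> \<le> vec_space.rank m (minkowski_adjoint R)"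
    using vec_space.rank_mult_le_left
      [OF minkowski_adjoint_carrier[OF CR(2)] minkowski_adjoint_carrier[OF CR(1)]] .
  also have "\<dots> \<le> ?r" using vec_space.rank_le_nc[OF minkowski_adjoint_carrier[OF CR(2)]] .
  finally show ?thesis .
qed

lemma rank_minkowski_adjoint:
  assumes A: "A \<in> carrier_mat n m"
  shows "vec_space.rank m (minkowski_adjoint A) = vec_space.rank n A"
  using rank_minkowski_adjoint_le[OF A] rank_minkowski_adjoint_le[of "minkowski_adjoint A" m n] A
  by (simp add: minkowski_adjoint_involutive[OF A])

text \<open>
  The adjoint is an involution that reverses products and keeps ranks, so it turns the statement
  about right factors into the one about left factors.
\<close>
lemma left_factor_if_rank_mult_eq:
  fixes A :: "complex mat"
  assumes A: "A \<in> carrier_mat n m" and B: "B \<in> carrier_mat p n"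
    and rk: "vec_space.rank p (B * A) = vec_space.rank n A"
  obtains Z where "Z \<in> carrier_mat n p" "A = Z * (B * A)"
proof -
  note A' = minkowski_adjoint_carrier[OF A] and B' = minkowski_adjoint_carrier[OF B]
  have BA: "B * A \<in> carrier_mat p m" using A B by simp
  have adj: "minkowski_adjoint (B * A) = minkowski_adjoint A * minkowski_adjoint B"
    using minkowski_adjoint_mult[OF B A] .
  have "vec_space.rank m (minkowski_adjoint A * minkowski_adjoint B) =
      vec_space.rank m (minkowski_adjoint A)"
    using rk rank_minkowski_adjoint[OF A] rank_minkowski_adjoint[OF BA] by (simp add: adj)
  from vec_space.right_factor_if_rank_mult_eq[OF A' B' this]
  obtain Y where Y: "Y \<in> carrier_mat p n"
    "minkowski_adjoint A = minkowski_adjoint (B * A) * Y"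
    unfolding adj .
  have "A = minkowski_adjoint (minkowski_adjoint (B * A) * Y)"
    unfolding Y(2)[symmetric] by (rule minkowski_adjoint_involutive[OF A, symmetric])
  also have "\<dots> = minkowski_adjoint Y * (B * A)"
    unfolding minkowski_adjoint_mult[OF minkowski_adjoint_carrier[OF BA] Y(1)]
      minkowski_adjoint_involutive[OF BA] ..
  finally show ?thesis by (rule that[OF minkowski_adjoint_carrier[OF Y(1)]])
qed

section \<open>The inverse along a matrix\<close>

text \<open>
  Mary's inverse of \<open>A\<close> along \<open>D\<close>, for square matrices of order \<open>n\<close>. The two divisibility
  conditions confine the column space and the row space of \<open>X\<close> to those of \<open>D\<close>; on these spaces
  the two equations make \<open>X\<close> invert \<open>A\<close>.
\<close>
definition is_inverse_along :: "nat \<Rightarrow> 'a::semiring_1 mat \<Rightarrow> 'a mat \<Rightarrow> 'a mat \<Rightarrow> bool" where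
  "is_inverse_along n A D X \<longleftrightarrow> X * A * D = D \<and> D * A * X = D \<and>
     (\<exists>Y \<in> carrier_mat n n. X = D * Y) \<and> (\<exists>Z \<in> carrier_mat n n. X = Z * D)"

text \<open>
  If $X = ZD$ and $X' = DY$, then both equal $XAX'$: insert $D = DAX'$ into the first equation and
  $D = XAD$ into the second.
\<close>
lemma is_inverse_along_unique:
  assumes "A \<in> carrier_mat n n" "D \<in> carrier_mat n n"
    and X: "is_inverse_along n A D X" and X': "is_inverse_along n A D X'"
  shows "X = X'"
proof -
  obtain Z where Z: "Z \<in> carrier_mat n n" "X = Z * D"
    using X by (auto simp: is_inverse_along_def)
  obtain Y where Y: "Y \<in> carrier_mat n n" "X' = D * Y"
    using X' by (auto simp: is_inverse_along_def)
  note mult = assoc_mult_mat[of _ n n _ n _ n] mult_carrier_mat[of _ n n _ n]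
  have "X = Z * (D * A * X')" using Z X' by (simp add: is_inverse_along_def)
  also have "\<dots> = X * A * D * Y" using assms(1,2) Y Z by (simp add: mult)
  also have "\<dots> = X'" using X Y by (simp add: is_inverse_along_def)
  finally show ?thesis .
qed

text \<open>
  As $X = DY$, the equation $XAD = D$ extends to $XAX = X$.
\<close>
lemma is_inverse_along_outer:
  assumes "A \<in> carrier_mat n n" "D \<in> carrier_mat n n"
    and X: "is_inverse_along n A D X"
  shows "X \<in> carrier_mat n n" "X * A * X = X"
proof -
  obtain Y where Y: "Y \<in> carrier_mat n n" "X = D * Y"
    using X by (auto simp: is_inverse_along_def)
  show C: "X \<in> carrier_mat n n" using Y assms(2) by simp
  have "X * A * X = X * A * D * Y"
    by (subst (2) Y(2)) (use assms(1,2) Y C in \<open>simp add: assoc_mult_mat[of _ n n _ n _ n]\<close>)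
  then show "X * A * X = X" using X Y(2) by (simp add: is_inverse_along_def)
qed

text \<open>
  From $D = (DAD)Y$ and $D = Z(DAD)$ it follows that $ZD = ZDADY = DY$. This common value is the inverse.
\<close>
lemma is_inverse_along_exists:
  fixes A D :: "complex mat"
  assumes A: "A \<in> carrier_mat n n" and D: "D \<in> carrier_mat n n"
    and rk: "vec_space.rank n (D * A * D) = vec_space.rank n D"
  obtains X where "is_inverse_along n A D X"
proof -
  note mult = assoc_mult_mat[of _ n n _ n _ n] mult_carrier_mat[of _ n n _ n]
  have AD: "A * D \<in> carrier_mat n n" and DA: "D * A \<in> carrier_mat n n" using A D by simp_all
  have "vec_space.rank n (D * (A * D)) = vec_space.rank n D" using rk A D by (simp add: mult)
  from vec_space.right_factor_if_rank_mult_eq[OF D AD this]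
  obtain Y where Y: "Y \<in> carrier_mat n n" "D = D * (A * D) * Y" .
  from left_factor_if_rank_mult_eq[OF D DA rk]
  obtain Z where Z: "Z \<in> carrier_mat n n" "D = Z * (D * A * D)" .
  have "Z * D = Z * (D * (A * D) * Y)" by (simp flip: Y(2))
  also have "\<dots> = Z * (D * A * D) * Y" using A D Y(1) Z(1) by (simp add: mult)
  also have "\<dots> = D * Y" by (simp flip: Z(2))
  finally have ZY: "Z * D = D * Y" .
  have "Z * D * A * D = Z * (D * A * D)" using Z(1) A D by (simp add: mult)
  then have "Z * D * A * D = D" by (simp flip: Z(2))
  moreover have "D * A * (D * Y) = D * (A * D) * Y" using Y(1) A D by (simp add: mult)
  then have "D * A * (D * Y) = D" by (simp flip: Y(2))
  ultimately have "is_inverse_along n A D (D * Y)"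
    unfolding is_inverse_along_def using Y(1) Z(1) ZY by metis
  with that show ?thesis .
qed

section \<open>The Drazin inverse\<close>

lemma pow_mat_add:
  fixes A :: "'a::semiring_1 mat"
  assumes A: "A \<in> carrier_mat n n"
  shows "A ^\<^sub>m (i + j) = A ^\<^sub>m i * A ^\<^sub>m j"
proof (induction j)
  case (Suc j)
  then show ?case
    using A assoc_mult_mat[of "A ^\<^sub>m i" n n "A ^\<^sub>m j" n A n] by simp
qed (use A in simp)

lemma pow_mat_Suc_left:
  fixes A :: "'a::semiring_1 mat"
  assumes A: "A \<in> carrier_mat n n"
  shows "A ^\<^sub>m Suc j = A * A ^\<^sub>m j"
  using pow_mat_add[OF A, of 1 j] A by simp

text \<open>
  The ranks of the powers form a non-increasing sequence of natural numbers, so two consecutive ones agree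
  somewhere and the least such exponent exists.
\<close>
lemma rank_pow_mat_index:
  assumes A: "A \<in> carrier_mat n n"
  shows "vec_space.rank n (A ^\<^sub>m Suc (mat_index A)) = vec_space.rank n (A ^\<^sub>m mat_index A)"
proof -
  define f where "f k = vec_space.rank n (A ^\<^sub>m k)" for k
  have le: "f (Suc k) \<le> f k" for k
    using vec_space.rank_mult_le_left[of "A ^\<^sub>m k" n n A n] A by (simp add: f_def)
  have "\<exists>k. f (Suc k) = f k"
  proof (rule ccontr)
    assume "\<nexists>k. f (Suc k) = f k"
    then have less: "f (Suc k) < f k" for k using le[of k] by (simp add: order_less_le)
    have "f k + k \<le> f 0" for k
    proof (induction k)
      case (Suc k)
      then show ?case using less[of k] by simp
    qed simp
    from this[of "Suc (f 0)"] show False by simp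
  qed
  then have "\<exists>k. mat_rank (A ^\<^sub>m (k + 1)) = mat_rank (A ^\<^sub>m k)"
    using A by (simp add: f_def)
  from LeastI_ex[OF this, folded mat_index_def] show ?thesis using A by simp
qed

text \<open>
  The equality of two consecutive ranks propagates to all larger exponents: if $A^k = A^{k+1}W$ then
  $A^{j+k} = A^{j+k+1}W$.
\<close>
lemma right_factor_pow_mat_index:
  assumes A: "A \<in> carrier_mat n n"
  shows "\<exists>Y \<in> carrier_mat n n. A ^\<^sub>m mat_index A = A ^\<^sub>m (j + mat_index A) * Y"
proof (induction j)
  case 0
  show ?case using A by (intro bexI[of _ "1\<^sub>m n"]) simp_all
next
  case (Suc j)
  let ?k = "mat_index A"
  note mult = assoc_mult_mat[of _ n n _ n _ n] mult_carrier_mat[of _ n n _ n]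
  have P: "A ^\<^sub>m i \<in> carrier_mat n n" for i using A by simp
  from Suc obtain Y where Y: "Y \<in> carrier_mat n n" "A ^\<^sub>m ?k = A ^\<^sub>m (j + ?k) * Y" by blast
  have "vec_space.rank n (A ^\<^sub>m ?k * A) = vec_space.rank n (A ^\<^sub>m ?k)"
    using rank_pow_mat_index[OF A] by simp
  from vec_space.right_factor_if_rank_mult_eq[OF P A this]
  obtain W where W: "W \<in> carrier_mat n n" "A ^\<^sub>m ?k = A ^\<^sub>m ?k * A * W" .
  have "A ^\<^sub>m (j + ?k) = A ^\<^sub>m j * (A ^\<^sub>m ?k * A * W)"
    unfolding W(2)[symmetric] by (rule pow_mat_add[OF A])
  also have "\<dots> = A ^\<^sub>m (Suc j + ?k) * W"
    using A W(1) P by (simp only: pow_mat_add[OF A] pow_mat.simps add_Suc)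
      (simp add: mult)
  finally have "A ^\<^sub>m ?k = A ^\<^sub>m (Suc j + ?k) * W * Y" using Y(2) by metis
  then have "A ^\<^sub>m ?k = A ^\<^sub>m (Suc j + ?k) * (W * Y)"
    using assoc_mult_mat[OF P W(1) Y(1)] by metis
  then show ?case using W(1) Y(1) by (intro bexI[of _ "W * Y"]) simp_all
qed

lemma pow_mat_commute:
  fixes A B :: "'a::semiring_1 mat"
  assumes A: "A \<in> carrier_mat n n" and B: "B \<in> carrier_mat n n" and AB: "A * B = B * A"
  shows "A * B ^\<^sub>m j = B ^\<^sub>m j * A"
proof (induction j)
  case (Suc j)
  note mult = assoc_mult_mat[of _ n n _ n _ n] mult_carrier_mat[of _ n n _ n]
  have P: "B ^\<^sub>m j \<in> carrier_mat n n" using B by simp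
  have "A * B ^\<^sub>m Suc j = (A * B ^\<^sub>m j) * B" using A B P by (simp add: mult)
  also have "\<dots> = B ^\<^sub>m j * (A * B)" unfolding Suc using A B P by (simp add: mult)
  also have "\<dots> = B ^\<^sub>m Suc j * A" unfolding AB using A B P by (simp add: mult)
  finally show ?case .
qed (use A B in simp)

text \<open>
  As $X$ commutes with $A$, iterating $X = X^2A$ gives $X = X^{k+1}A^k = A^kX^{k+1}$.
\<close>
lemma is_inverse_along_if_drazin:
  assumes A: "A \<in> carrier_mat n n" and "is_drazin_inverse A X"
  shows "is_inverse_along n A (A ^\<^sub>m mat_index A) X"
proof -
  let ?k = "mat_index A"
  let ?D = "A ^\<^sub>m ?k"
  note mult = assoc_mult_mat[of _ n n _ n _ n] mult_carrier_mat[of _ n n _ n]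
  have X: "X \<in> carrier_mat n n" "X * A * X = X" "A * X = X * A" "?D * A * X = ?D"
    using assms by (auto simp: is_drazin_inverse_def)
  have P: "A ^\<^sub>m i \<in> carrier_mat n n" and Q: "X ^\<^sub>m i \<in> carrier_mat n n" for i
    using A X(1) by simp_all
  have "X * (A * X) = X" using A X(1,2) by (simp add: mult)
  then have XXA: "X * X * A = X" using A X(1) by (simp add: X(3) mult)
  have fac: "X ^\<^sub>m Suc j * A ^\<^sub>m j = X" for j
  proof (induction j)
    case 0
    show ?case using A X(1) by simp
  next
    case (Suc j)
    have "X ^\<^sub>m Suc (Suc j) * A ^\<^sub>m Suc j = X ^\<^sub>m j * (X * X * A) * A ^\<^sub>m j"
      unfolding pow_mat_Suc_left[OF A] using A X(1) P Q by (simp add: mult)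
    also have "\<dots> = X" using Suc by (simp add: XXA)
    finally show ?case .
  qed
  have XD: "X * ?D = ?D * X" by (rule pow_mat_commute[OF X(1) A]) (simp add: X(3))
  have DX: "?D * X ^\<^sub>m Suc ?k = X ^\<^sub>m Suc ?k * ?D"
    by (rule pow_mat_commute[OF P X(1)]) (simp add: XD)
  have "X * A * ?D = X * A ^\<^sub>m Suc ?k"
    unfolding pow_mat_Suc_left[OF A] using A X(1) P by (simp add: mult)
  also have "\<dots> = A ^\<^sub>m Suc ?k * X"
    by (rule pow_mat_commute[OF X(1) A]) (simp add: X(3))
  finally have "X * A * ?D = ?D" using X(4) by simp
  then show ?thesis
    unfolding is_inverse_along_def using X(4) fac[of ?k] DX Q by metis
qed

text \<open>
  Commutation is what needs an argument. As $A$ commutes with $A^k$, the product $AX$ is a right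
  multiple of $A^k$, hence is fixed by $XA$ from the left. In the same way $XA$ is a left multiple of
  $A^k$, hence is fixed by $AX$ from the right. So both equal $(XA)(AX)$.
\<close>
lemma drazin_if_is_inverse_along:
  assumes A: "A \<in> carrier_mat n n" and X: "is_inverse_along n A (A ^\<^sub>m mat_index A) X"
  shows "is_drazin_inverse A X"
proof -
  let ?D = "A ^\<^sub>m mat_index A"
  note mult = assoc_mult_mat[of _ n n _ n _ n] mult_carrier_mat[of _ n n _ n]
  have D: "?D \<in> carrier_mat n n" using A by simp
  have AD: "A * ?D = ?D * A" using pow_mat_Suc_left[OF A] by simp
  note XC = is_inverse_along_outer(1)[OF A D X] and XAX = is_inverse_along_outer(2)[OF A D X]
  obtain Y Z where Y: "Y \<in> carrier_mat n n" "X = ?D * Y" and Z: "Z \<in> carrier_mat n n" "X = Z * ?D"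
    and X1: "X * A * ?D = ?D" and X2: "?D * A * X = ?D"
    using X by (auto simp: is_inverse_along_def)
  have AX: "A * X = ?D * A * Y"
    unfolding AD[symmetric] using A D Y by (simp add: mult)
  have XA: "X * A = Z * A * ?D"
    using A D Z by (simp add: mult AD)
  have "X * A * (A * X) = X * A * ?D * A * Y"
    unfolding AX using A D XC Y(1) by (simp add: mult)
  then have 1: "X * A * (A * X) = A * X" by (simp add: X1 AX)
  have "X * A * (A * X) = Z * A * (?D * A * X)"
    unfolding XA using A D XC Z(1) by (simp add: mult)
  then have "X * A * (A * X) = X * A" by (simp add: X2 XA)
  with 1 have "A * X = X * A" by simp
  moreover have "A ^\<^sub>m (mat_index A + 1) * X = ?D" using X2 by simp
  ultimately show ?thesis
    unfolding is_drazin_inverse_def using A XC XAX by simp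
qed

text \<open>
  With $d = A^k$ the product $dAd$ is $A^{2k+1}$. Each of $A^k$ and $A^{2k+1}$ is a right multiple of
  the other, so they have the same rank and the inverse along $A^k$ exists.
\<close>
lemma drazin_inverse:
  assumes A: "A \<in> carrier_mat n n"
  shows "is_drazin_inverse A (drazin_inverse A)"
proof -
  let ?D = "A ^\<^sub>m mat_index A"
  note mult = assoc_mult_mat[of _ n n _ n _ n] mult_carrier_mat[of _ n n _ n]
  have D: "?D \<in> carrier_mat n n" using A by simp
  obtain Y where Y: "Y \<in> carrier_mat n n"
    "?D = A ^\<^sub>m (Suc (mat_index A) + mat_index A) * Y"
    using right_factor_pow_mat_index[OF A] by blast
  have pow: "A ^\<^sub>m (Suc (mat_index A) + mat_index A) = ?D * A * ?D"
    by (simp only: pow_mat_add[OF A] pow_mat.simps)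
  have DAD: "?D * A * ?D \<in> carrier_mat n n" using A D by (simp add: mult)
  have "vec_space.rank n ?D \<le> vec_space.rank n (?D * A * ?D)"
    using vec_space.rank_mult_le_left[OF DAD Y(1)]
    by (simp only: Y(2)[unfolded pow, symmetric])
  moreover have "vec_space.rank n (?D * A * ?D) \<le> vec_space.rank n ?D"
    using vec_space.rank_mult_le_left[of ?D n n "A * ?D" n] A D by (simp add: mult)
  ultimately obtain X where "is_inverse_along n A ?D X"
    using is_inverse_along_exists[OF A D] by (metis le_antisym)
  then have X: "is_drazin_inverse A X" by (rule drazin_if_is_inverse_along[OF A])
  show ?thesis unfolding drazin_inverse_def
    by (rule theI[of "is_drazin_inverse A", OF X])
      (use is_inverse_along_unique[OF A D] is_inverse_along_if_drazin[OF A] X in blast)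
qed

section \<open>The Minkowski inverse\<close>

text \<open>
  The adjoint of $A(XA) = A$ is $(XA)A^\sim = A^\sim$ since $XA$ is self-adjoint, and similarly on the
  other side. Moreover $X = X(AX) = XX^\sim A^\sim$ and $X = (XA)X = A^\sim X^\sim X$.
\<close>
lemma is_inverse_along_if_minkowski:
  assumes A: "A \<in> carrier_mat n n" and "is_minkowski_inverse A X"
  shows "is_inverse_along n A (minkowski_adjoint A) X"
proof -
  let ?B = "minkowski_adjoint A"
  let ?Y = "minkowski_adjoint X"
  note mult = assoc_mult_mat[of _ n n _ n _ n] mult_carrier_mat[of _ n n _ n]
  have X: "X \<in> carrier_mat n n" "A * X * A = A" "X * A * X = X"
    "minkowski_adjoint (A * X) = A * X" "minkowski_adjoint (X * A) = X * A"
    using assms by (auto simp: is_minkowski_inverse_def)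
  have B: "?B \<in> carrier_mat n n" and Y: "?Y \<in> carrier_mat n n" using A X(1) by simp_all
  have AX: "A * X = ?Y * ?B" using X(4) minkowski_adjoint_mult[OF A X(1)] by simp
  have XA: "X * A = ?B * ?Y" using X(5) minkowski_adjoint_mult[OF X(1) A] by simp
  have "minkowski_adjoint (A * (X * A)) = X * A * ?B"
    using minkowski_adjoint_mult[of A n n "X * A" n] A X(1,5) by simp
  then have "X * A * ?B = ?B" using X(1,2) A by (simp add: mult)
  moreover have "minkowski_adjoint (A * X * A) = ?B * (A * X)"
    using minkowski_adjoint_mult[of "A * X" n n A n] A X(1,4) by simp
  then have "?B * A * X = ?B" using X(1,2) A B by (simp add: mult)
  moreover have "X = X * ?Y * ?B"
  proof -
    have "X = X * (A * X)" using X(1,3) A by (simp add: mult)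
    then show ?thesis unfolding AX using X(1) Y B by (simp add: mult)
  qed
  moreover have "X = ?B * (?Y * X)"
  proof -
    have "X = X * A * X" using X(3) by simp
    then show ?thesis unfolding XA using X(1) Y B by (simp add: mult)
  qed
  moreover have "X * ?Y \<in> carrier_mat n n" "?Y * X \<in> carrier_mat n n"
    using X(1) Y by (simp_all add: mult)
  ultimately show ?thesis unfolding is_inverse_along_def by blast
qed

text \<open>
  The product of a matrix with its adjoint, in either order, is self-adjoint, and here $E$ is such a
  product.
\<close>
lemma minkowski_adjoint_eq_self:
  assumes E: "E \<in> carrier_mat n n" and "minkowski_adjoint E * E = E \<or> E * minkowski_adjoint E = E"
  shows "minkowski_adjoint E = E"
proof -
  have E': "minkowski_adjoint E \<in> carrier_mat n n" using E by simp
  show ?thesis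
    using assms(2) minkowski_adjoint_mult[OF E E'] minkowski_adjoint_mult[OF E' E]
      minkowski_adjoint_involutive[OF E] by auto
qed

text \<open>
  The adjoints of $A^\sim AX = A^\sim$ and $XAA^\sim = A^\sim$ are $(AX)^\sim A = A$ and
  $A(XA)^\sim = A$. Multiplied by $X$, they give $(AX)^\sim AX = AX$ and $XA(XA)^\sim = XA$, so that
  $AX$ and $XA$ are self-adjoint. Then the first adjoint reads $AXA = A$.
\<close>
lemma minkowski_if_is_inverse_along:
  assumes A: "A \<in> carrier_mat n n" and X: "is_inverse_along n A (minkowski_adjoint A) X"
  shows "is_minkowski_inverse A X"
proof -
  let ?B = "minkowski_adjoint A"
  note mult = assoc_mult_mat[of _ n n _ n _ n] mult_carrier_mat[of _ n n _ n]
  have B: "?B \<in> carrier_mat n n" using A by simp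
  note XC = is_inverse_along_outer(1)[OF A B X] and XAX = is_inverse_along_outer(2)[OF A B X]
  have AX: "A * X \<in> carrier_mat n n" and XA: "X * A \<in> carrier_mat n n" using A XC by simp_all
  have XAB: "X * A * ?B = ?B" and BAX: "?B * A * X = ?B"
    using X by (simp_all add: is_inverse_along_def)
  have "minkowski_adjoint (?B * (A * X)) = minkowski_adjoint (A * X) * A"
    using minkowski_adjoint_mult[OF B AX] by (simp add: minkowski_adjoint_involutive[OF A])
  then have 1: "minkowski_adjoint (A * X) * A = A"
    using BAX A B XC by (simp add: mult minkowski_adjoint_involutive[OF A])
  have "minkowski_adjoint (X * A * ?B) = A * minkowski_adjoint (X * A)"
    using minkowski_adjoint_mult[OF XA B] by (simp add: minkowski_adjoint_involutive[OF A])
  then have 2: "A * minkowski_adjoint (X * A) = A"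
    unfolding XAB by (simp add: minkowski_adjoint_involutive[OF A])
  have "minkowski_adjoint (A * X) * (A * X) = A * X"
    using assoc_mult_mat[OF minkowski_adjoint_carrier[OF AX] A XC] 1 by simp
  then have H1: "minkowski_adjoint (A * X) = A * X"
    by (intro minkowski_adjoint_eq_self[OF AX] disjI1)
  have "X * A * minkowski_adjoint (X * A) = X * A"
    using assoc_mult_mat[OF XC A minkowski_adjoint_carrier[OF XA]] 2 by simp
  then have H2: "minkowski_adjoint (X * A) = X * A"
    by (intro minkowski_adjoint_eq_self[OF XA] disjI2)
  have "A * X * A = A" using 1 H1 by simp
  then show ?thesis
    unfolding is_minkowski_inverse_def using A XC XAX H1 H2 by simp
qed

lemma minkowski_inverse:
  assumes A: "A \<in> carrier_mat n n"
    and rk: "vec_space.rank n (minkowski_adjoint A * A * minkowski_adjoint A) = vec_space.rank n A"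
  shows "is_minkowski_inverse A (minkowski_inverse A)"
proof -
  have B: "minkowski_adjoint A \<in> carrier_mat n n" using A by simp
  obtain X where "is_inverse_along n A (minkowski_adjoint A) X"
    using is_inverse_along_exists[OF A B] rk rank_minkowski_adjoint[OF A] by metis
  then have X: "is_minkowski_inverse A X" by (rule minkowski_if_is_inverse_along[OF A])
  show ?thesis unfolding minkowski_inverse_def
    by (rule theI[of "is_minkowski_inverse A", OF X])
      (use is_inverse_along_unique[OF A B] is_inverse_along_if_minkowski[OF A] X in blast)
qed

section \<open>The linear system\<close>

text \<open>
  The solutions of $Fx = Fc$ are $Fc$ plus the kernel of $F$, and the kernel of an idempotent is the
  range of the complementary idempotent $I - F$.
\<close>
lemma idempotent_solution_set:
  fixes F :: "'a::comm_ring_1 mat"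
  assumes F: "F \<in> carrier_mat n n" and FF: "F * F = F" and c: "c \<in> carrier_vec n"
  shows "{x \<in> carrier_vec n. F *\<^sub>v x = F *\<^sub>v c} =
    {F *\<^sub>v c + (1\<^sub>m n - F) *\<^sub>v v | v. v \<in> carrier_vec n}"
proof (intro equalityI subsetI)
  fix x assume "x \<in> {x \<in> carrier_vec n. F *\<^sub>v x = F *\<^sub>v c}"
  then have x: "x \<in> carrier_vec n" "F *\<^sub>v x = F *\<^sub>v c" by auto
  have "F *\<^sub>v c + (1\<^sub>m n - F) *\<^sub>v x = F *\<^sub>v x + (x - F *\<^sub>v x)"
    using x F by (simp add: minus_mult_distrib_mat_vec[of _ n n])
  also have "\<dots> = x" using x(1) F by (intro eq_vecI) auto
  finally show "x \<in> {F *\<^sub>v c + (1\<^sub>m n - F) *\<^sub>v v | v. v \<in> carrier_vec n}"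
    using x(1) by (intro CollectI exI[of _ x]) simp
next
  fix x assume "x \<in> {F *\<^sub>v c + (1\<^sub>m n - F) *\<^sub>v v | v. v \<in> carrier_vec n}"
  then obtain v where v: "v \<in> carrier_vec n" "x = F *\<^sub>v c + (1\<^sub>m n - F) *\<^sub>v v" by auto
  have FFv: "F *\<^sub>v (F *\<^sub>v u) = F *\<^sub>v u" if "u \<in> carrier_vec n" for u
    using assoc_mult_mat_vec[OF F F that] by (simp add: FF)
  have x: "x = F *\<^sub>v c + (v - F *\<^sub>v v)"
    using v F by (simp add: minus_mult_distrib_mat_vec[of _ n n])
  have "F *\<^sub>v x = F *\<^sub>v (F *\<^sub>v c) + (F *\<^sub>v v - F *\<^sub>v (F *\<^sub>v v))"
    unfolding x using v(1) F c
    by (simp add: mult_add_distrib_mat_vec[of _ n n] mult_minus_distrib_mat_vec[of _ n n])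
  also have "\<dots> = F *\<^sub>v c" using v(1) F c by (intro eq_vecI) (simp_all add: FFv)
  finally show "x \<in> {x \<in> carrier_vec n. F *\<^sub>v x = F *\<^sub>v c}"
    using x v(1) F c by simp
qed

theorem theorem5p1:
  fixes A :: "complex mat" and b :: "complex vec" and n k :: nat
  assumes "n \<ge> 1"
    and "A \<in> carrier_mat n n"
    and "mat_index A = k"
    and "mat_rank (minkowski_adjoint A * A * minkowski_adjoint A) = mat_rank A"
    and "b \<in> carrier_vec n"
  shows "{x \<in> carrier_vec n. A ^\<^sub>m k *\<^sub>v x = (A ^\<^sub>m k * minkowski_inverse A) *\<^sub>v b} =
           {m_DMP_inverse A *\<^sub>v b + (1\<^sub>m n - m_DMP_inverse A * A) *\<^sub>v v | v. v \<in> carrier_vec n}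
       \<and> {x \<in> mat_range (A ^\<^sub>m k). A ^\<^sub>m k *\<^sub>v x = (A ^\<^sub>m k * minkowski_inverse A) *\<^sub>v b} =
           {m_DMP_inverse A *\<^sub>v b}"
proof -
  let ?P = "A ^\<^sub>m k"
  define D where "D = drazin_inverse A"
  define M where "M = minkowski_inverse A"
  note A = assms(2)
  note mult = assoc_mult_mat[of _ n n _ n _ n] mult_carrier_mat[of _ n n _ n]
    and vmult = assoc_mult_mat_vec[of _ n n _ n]
  have P: "?P \<in> carrier_mat n n" using A by simp
  have "vec_space.rank n (minkowski_adjoint A * A * minkowski_adjoint A) = vec_space.rank n A"
    using assms(4) carrier_matD(1)[OF A] carrier_matD(1)[OF minkowski_adjoint_carrier[OF A]]
    by (simp only: index_mult_mat)
  from minkowski_inverse[OF A this]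
  have M: "M \<in> carrier_mat n n" and AMA: "A * M * A = A"
    using A by (auto simp: is_minkowski_inverse_def M_def)
  have dz: "is_drazin_inverse A D" unfolding D_def by (rule drazin_inverse[OF A])
  then have D: "D \<in> carrier_mat n n" and DA: "A * D = D * A" and PAD: "?P * A * D = ?P"
    using A assms(3) by (auto simp: is_drazin_inverse_def)
  have PDA: "?P * (D * A) = ?P" using PAD A P D by (simp add: mult flip: DA)
  obtain Y Z where Y: "Y \<in> carrier_mat n n" "D = ?P * Y" and Z: "Z \<in> carrier_mat n n" "D = Z * ?P"
    and DAP: "D * A * ?P = ?P"
    using is_inverse_along_if_drazin[OF A dz] assms(3) by (auto simp: is_inverse_along_def)
  have AP: "A * ?P = ?P * A" using pow_mat_Suc_left[OF A] by simp
  define F where "F = D * A"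
  have F: "F \<in> carrier_mat n n" using D A by (simp add: F_def)
  have X: "m_DMP_inverse A = F * M" by (simp add: m_DMP_inverse_def F_def D_def M_def)
  have XA: "m_DMP_inverse A * A = F"
    unfolding X F_def using A D M AMA by (simp add: mult)
  \<comment> \<open>The next four facts say that \<open>F\<close> has the kernel and the range of \<open>?P\<close>.\<close>
  have ZAP: "F = Z * A * ?P"
    unfolding F_def using A P Z by (simp add: mult AP)
  have PYA: "F = ?P * (Y * A)"
    unfolding F_def using A P Y by (simp add: mult)
  have FP: "F * ?P = ?P" using DAP by (simp add: F_def)
  have PF: "?P * F = ?P" using PDA by (simp add: F_def)
  define c where "c = M *\<^sub>v b"
  have c: "c \<in> carrier_vec n" using M assms(5) by (simp add: c_def)
  have Xb: "m_DMP_inverse A *\<^sub>v b = F *\<^sub>v c"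
    unfolding X c_def using F M assms(5) by (simp add: vmult)
  have rhs: "(?P * minkowski_inverse A) *\<^sub>v b = ?P *\<^sub>v c"
    using P M assms(5) by (simp add: vmult c_def flip: M_def)
  \<comment> \<open>\<open>F\<close> and \<open>?P\<close> are left multiples of each other.\<close>
  have solves: "?P *\<^sub>v x = ?P *\<^sub>v c \<longleftrightarrow> F *\<^sub>v x = F *\<^sub>v c" if x: "x \<in> carrier_vec n" for x
  proof
    assume "?P *\<^sub>v x = ?P *\<^sub>v c"
    then have "Z * A *\<^sub>v (?P *\<^sub>v x) = Z * A *\<^sub>v (?P *\<^sub>v c)" by simp
    moreover have "Z * A \<in> carrier_mat n n" using Z A by simp
    ultimately show "F *\<^sub>v x = F *\<^sub>v c"
      unfolding ZAP using P x c by (simp add: assoc_mult_mat_vec[of "Z * A" n n ?P n])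
  next
    assume "F *\<^sub>v x = F *\<^sub>v c"
    then have "?P *\<^sub>v (F *\<^sub>v x) = ?P *\<^sub>v (F *\<^sub>v c)" by simp
    then show "?P *\<^sub>v x = ?P *\<^sub>v c"
      using P F x c by (simp add: PF flip: vmult)
  qed
  have FF: "F * F = F"
  proof -
    have "F * F = F * ?P * (Y * A)"
      by (subst (2) PYA) (use F P Y A in \<open>simp add: mult\<close>)
    also have "\<dots> = F" by (simp only: FP PYA[symmetric])
    finally show ?thesis .
  qed
  have unique: "{x \<in> mat_range ?P. ?P *\<^sub>v x = ?P *\<^sub>v c} = {F *\<^sub>v c}"
  proof (intro equalityI subsetI)
    fix x assume "x \<in> {x \<in> mat_range ?P. ?P *\<^sub>v x = ?P *\<^sub>v c}"
    then obtain u where u: "u \<in> carrier_vec n" "x = ?P *\<^sub>v u" and "?P *\<^sub>v x = ?P *\<^sub>v c"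
      using A by (auto simp: mat_range_def split: if_splits)
    then have "F *\<^sub>v x = F *\<^sub>v c" using solves[of x] P by simp
    moreover have "F *\<^sub>v x = x" unfolding u(2) using F P u(1) by (simp add: FP flip: vmult)
    ultimately show "x \<in> {F *\<^sub>v c}" by simp
  next
    fix x assume "x \<in> {F *\<^sub>v c}"
    then have x: "x = F *\<^sub>v c" by simp
    have "x = ?P *\<^sub>v (Y * A *\<^sub>v c)"
      unfolding x PYA using P A Y c by (intro assoc_mult_mat_vec) auto
    moreover have "Y * A *\<^sub>v c \<in> carrier_vec (dim_col ?P)" using A Y(1) c by simp
    ultimately have "x \<in> mat_range ?P" unfolding mat_range_def by blast
    moreover have "?P *\<^sub>v x = ?P *\<^sub>v c" using solves[of x] x F c by (simp add: FF flip: vmult)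
    ultimately show "x \<in> {x \<in> mat_range ?P. ?P *\<^sub>v x = ?P *\<^sub>v c}" by simp
  qed
  have "{x \<in> carrier_vec n. ?P *\<^sub>v x = ?P *\<^sub>v c} = {x \<in> carrier_vec n. F *\<^sub>v x = F *\<^sub>v c}"
    using solves by blast
  then show ?thesis unfolding rhs Xb XA using idempotent_solution_set[OF F FF c] unique by simp
qed

end
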